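(* Let $G$ be a finite group. For each $x\in G$ let $[x]$ denote the set of all generators of the cyclic subgroup $\langle x\rangle$, and fix, for each distinct such set, an arbitrary linear ordering of its elements. For $x,y\in G$ write $x\prec y$ if either ($x,y$ lie in the same set $[x]=[y]$ and $x$ precedes $y$ in the fixed ordering of this set) or $\langle x\rangle\subsetneqq\langle y\rangle$. Let $\mathcal O_G$ be the digraph with vertex set $G$ having an arc from $x$ to $y$ if and only if $y\prec x$. Then $\mathcal O_G$ is a transitive orientation of the power graph $\mathcal P_G$ and is a subdigraph of the power digraph $\overrightarrow{\mathcal P}_G$. Moreover, if $\mathcal O'$ is any transitive orientation of $\mathcal P_G$ that is a subdigraph of $\overrightarrow{\mathcal P}_G$, then $\mathcal O'$ and $\mathcal O_G$ are isomorphic digraphs.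
   Context: All groups are finite. The power graph $\mathcal P_G$ has vertex set $G$, two distinct elements being adjacent iff one is a power of the other. The power digraph $\overrightarrow{\mathcal P}_G$ has vertex set $G$ and an arc from $x$ to $y$ iff $x\neq y$ and $y=x^m$ for some positive integer $m$. An orientation of a graph $\Gamma$ is a digraph $\mathcal O$ on $V(\Gamma)$ such that for each edge $\{u,v\}$ of $\Gamma$ exactly one of $(u,v),(v,u)$ is an arc of $\mathcal O$, and $\mathcal O$ has no other arcs; it is transitive if arcs $(u,v),(v,w)$ imply the arc $(u,w)$. *)

theory Defs
  imports "HOL-Algebra.Generated_Groups" "Graph_Theory.Graph_Theory"
begin

text \<open>
  Digraphs without multiple arcs are \<^typ>\<open>'a pair_pre_digraph\<close>; as in the AFP entry on graph theory, an
  undirected graph is a symmetric digraph, so that an edge \<open>{u, v}\<close> is the pair of arcs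
  \<open>(u, v)\<close> and \<open>(v, u)\<close>.
\<close>

definition is_pos_power :: "('a, 'b) monoid_scheme \<Rightarrow> 'a \<Rightarrow> 'a \<Rightarrow> bool" where
  "is_pos_power G y x \<longleftrightarrow> (\<exists>m::nat. 0 < m \<and> y = x [^]\<^bsub>G\<^esub> m)"

definition power_graph :: "('a, 'b) monoid_scheme \<Rightarrow> 'a pair_pre_digraph" where
  "power_graph G =
     \<lparr> pverts = carrier G,
       parcs = {(x, y). x \<in> carrier G \<and> y \<in> carrier G \<and> x \<noteq> y \<and>
                        (is_pos_power G x y \<or> is_pos_power G y x)} \<rparr>"

definition power_digraph :: "('a, 'b) monoid_scheme \<Rightarrow> 'a pair_pre_digraph" where
  "power_digraph G =
     \<lparr> pverts = carrier G,
       parcs = {(x, y). x \<in> carrier G \<and> y \<in> carrier G \<and> x \<noteq> y \<and> is_pos_power G y x} \<rparr>"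

definition orientation :: "'a pair_pre_digraph \<Rightarrow> 'a pair_pre_digraph \<Rightarrow> bool" where
  "orientation \<Gamma> D \<longleftrightarrow>
     pverts D = pverts \<Gamma> \<and>
     (\<forall>(u, v) \<in> parcs \<Gamma>. ((u, v) \<in> parcs D) \<noteq> ((v, u) \<in> parcs D)) \<and>
     parcs D \<subseteq> parcs \<Gamma>"

definition transitive_orientation :: "'a pair_pre_digraph \<Rightarrow> 'a pair_pre_digraph \<Rightarrow> bool" where
  "transitive_orientation \<Gamma> D \<longleftrightarrow> orientation \<Gamma> D \<and> trans (parcs D)"

definition gen_class :: "('a, 'b) monoid_scheme \<Rightarrow> 'a \<Rightarrow> 'a set" where
  "gen_class G x = {y \<in> generate G {x}. generate G {y} = generate G {x}}"

text \<open>
  \<open>L\<close> assigns to each class \<open>gen_class G x\<close> its (reflexive) linear order; \<open>x\<close> precedes \<open>y\<close> in it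
  if \<open>(x, y)\<close> belongs to its strict part.
\<close>

definition prec :: "('a, 'b) monoid_scheme \<Rightarrow> ('a set \<Rightarrow> 'a rel) \<Rightarrow> 'a \<Rightarrow> 'a \<Rightarrow> bool" where
  "prec G L x y \<longleftrightarrow>
     gen_class G x = gen_class G y \<and> (x, y) \<in> L (gen_class G x) \<and> x \<noteq> y \<or>
     generate G {x} \<subset> generate G {y}"

definition order_digraph ::
    "('a, 'b) monoid_scheme \<Rightarrow> ('a set \<Rightarrow> 'a rel) \<Rightarrow> 'a pair_pre_digraph" where
  "order_digraph G L =
     \<lparr> pverts = carrier G,
       parcs = {(x, y). x \<in> carrier G \<and> y \<in> carrier G \<and> prec G L y x} \<rparr>"

end

theory Submission
  imports Defs "HOL-Algebra.Multiplicative_Group"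
begin

text \<open>
  In a finite group, \<open>y\<close> is a positive power of \<open>x\<close> iff \<open>\<langle>y\<rangle> \<subseteq> \<langle>x\<rangle>\<close>. Hence a digraph is a transitive
  orientation of the power graph inside the power digraph iff it contains all arcs going down
  between different cyclic subgroups, no arcs going up, and a strict linear order on each class of
  generators of the same cyclic subgroup. Two linear orders of a finite set are isomorphic, and
  applying such isomorphisms class by class does not change the cyclic subgroup generated by an
  element, so the arcs between different classes are preserved as well.
\<close>

section \<open>Isomorphisms of finite linear orders, glued along fibres\<close>

lemma finite_linear_order_iso:
  assumes "finite C" "linear_order_on C r" "linear_order_on C r'"
  obtains f where "bij_betw f C C" "\<And>x y. x \<in> C \<Longrightarrow> y \<in> C \<Longrightarrow> (x, y) \<in> r \<longleftrightarrow> (f x, f y) \<in> r'"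
proof -
  have wo: "well_order_on C s" if s: "linear_order_on C s" for s
  proof -
    have "s \<subseteq> C \<times> C"
      using s by (simp add: order_on_defs)
    then show ?thesis
      using s \<open>finite C\<close> linear_order_on_well_order_on finite_subset by blast
  qed
  \<comment> \<open>Finite well-orders of the same set are isomorphic, since the isomorphism type
    depends only on the cardinality.\<close>
  have "(r, r') \<in> ordIso"
    using finite_well_order_on_ordIso assms wo by blast
  then obtain f where "bij_betw f (Field r) (Field r')"
      "\<forall>x \<in> Field r. \<forall>y \<in> Field r. (x, y) \<in> r \<longleftrightarrow> (f x, f y) \<in> r'"
    by (auto simp: ordIso_def iso_iff2)
  moreover have "Field r = C" "Field r' = C"
    using assms well_order_on_Field wo by blast+
  ultimately show thesis
    using that[of f] by simp
qed

text \<open>Between different fibres of \<open>q\<close> the relation is dictated by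
  \<open>q\<close>; only the strict linear order inside each fibre is free. The values of
  \<open>q\<close> are merely partially ordered, as cyclic subgroups are by inclusion.\<close>

definition fibrewise_linear :: "'a set \<Rightarrow> ('a \<Rightarrow> 'c::order) \<Rightarrow> 'a rel \<Rightarrow> bool" where
  "fibrewise_linear A q R \<longleftrightarrow>
     R \<subseteq> A \<times> A \<and> trans R \<and> irrefl R \<and>
     (\<forall>x\<in>A. \<forall>y\<in>A. q y < q x \<longrightarrow> (x, y) \<in> R) \<and>
     (\<forall>(x, y)\<in>R. q y \<le> q x) \<and>
     (\<forall>x\<in>A. \<forall>y\<in>A. q x = q y \<longrightarrow> x \<noteq> y \<longrightarrow> (x, y) \<in> R \<or> (y, x) \<in> R)"

text \<open>\<open>linear_order_on\<close> describes reflexive orders, so the diagonal is added;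
  antisymmetry comes from transitivity and irreflexivity.\<close>

lemma fibrewise_linear_fibre:
  assumes "fibrewise_linear A q R"
  shows "linear_order_on {z \<in> A. q z = c}
    ((R \<union> Id) \<inter> {z \<in> A. q z = c} \<times> {z \<in> A. q z = c})"
  (is "linear_order_on ?C ?r")
proof -
  have R: "trans R" "irrefl R"
    and total: "\<And>x y. x \<in> A \<Longrightarrow> y \<in> A \<Longrightarrow> q x = q y \<Longrightarrow> x \<noteq> y \<Longrightarrow> (x, y) \<in> R \<or> (y, x) \<in> R"
    using assms by (auto simp: fibrewise_linear_def)
  have "trans ?r"
    using R(1) by (auto intro!: transI dest: transD)
  moreover have "antisym ?r"
    using R by (auto intro!: antisymI dest: transD simp: irrefl_def)
  moreover have "total_on ?C ?r"
    using total by (auto simp: total_on_def)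
  ultimately show ?thesis
    by (auto simp: order_on_defs refl_on_def)
qed

text \<open>Both relations agree between different fibres, so it suffices to match them inside each
  fibre by a permutation of that fibre.\<close>

lemma fibrewise_linear_iso:
  assumes "finite A" and R: "fibrewise_linear A q R" and R': "fibrewise_linear A q R'"
  obtains f where "bij_betw f A A" "\<And>x y. x \<in> A \<Longrightarrow> y \<in> A \<Longrightarrow> (x, y) \<in> R \<longleftrightarrow> (f x, f y) \<in> R'"
proof -
  let ?C = "\<lambda>c. {z \<in> A. q z = c}"
  let ?P = "\<lambda>c f. bij_betw f (?C c) (?C c) \<and>
      (\<forall>x\<in>?C c. \<forall>y\<in>?C c. (x, y) \<in> R \<or> x = y \<longleftrightarrow> (f x, f y) \<in> R' \<or> f x = f y)"
  have "\<exists>f. ?P c f" for c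
  proof -
    have "finite (?C c)"
      using \<open>finite A\<close> by simp
    then obtain f where f: "bij_betw f (?C c) (?C c)"
      and arcs: "\<And>x y. x \<in> ?C c \<Longrightarrow> y \<in> ?C c \<Longrightarrow>
        (x, y) \<in> (R \<union> Id) \<inter> ?C c \<times> ?C c \<longleftrightarrow> (f x, f y) \<in> (R' \<union> Id) \<inter> ?C c \<times> ?C c"
      using fibrewise_linear_fibre[OF R] fibrewise_linear_fibre[OF R']
      by (rule finite_linear_order_iso) (rule that)
    have "(x, y) \<in> R \<or> x = y \<longleftrightarrow> (f x, f y) \<in> R' \<or> f x = f y"
      if "x \<in> ?C c" "y \<in> ?C c" for x y
    proof -
      have "f x \<in> ?C c" "f y \<in> ?C c"
        using that bij_betwE[OF f] by blast+
      then show ?thesis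
        using arcs[OF that] that by simp
    qed
    then show ?thesis
      using f by blast
  qed
  \<comment> \<open>One isomorphism is chosen for every value \<open>c\<close>; empty fibres do no
    harm.\<close>
  then have "\<exists>F. \<forall>c. ?P c (F c)"
    by (intro choice allI)
  then obtain F where F: "\<And>c. bij_betw (F c) (?C c) (?C c)"
    and F': "\<And>c x y. x \<in> ?C c \<Longrightarrow> y \<in> ?C c \<Longrightarrow>
      (x, y) \<in> R \<or> x = y \<longleftrightarrow> (F c x, F c y) \<in> R' \<or> F c x = F c y"
    by blast
  \<comment> \<open>Each \<open>F c\<close> maps its fibre to itself, so the glued map preserves
    \<open>q\<close>.\<close>
  define f where "f x = F (q x) x" for x
  have fA: "f x \<in> A" "q (f x) = q x" if "x \<in> A" for x
    using bij_betwE[OF F] that unfolding f_def by auto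
  have inj: "inj_on f A"
  proof (rule inj_onI)
    fix x y assume xy: "x \<in> A" "y \<in> A" "f x = f y"
    then have "q x = q y"
      using fA by metis
    then show "x = y"
      using xy inj_onD[OF bij_betw_imp_inj_on[OF F[of "q x"]], of x y] by (simp add: f_def)
  qed
  have "f ` A \<subseteq> A"
    using fA by blast
  then have "bij_betw f A A"
    using inj \<open>finite A\<close> by (simp add: bij_betw_def endo_inj_surj)
  moreover have "(x, y) \<in> R \<longleftrightarrow> (f x, f y) \<in> R'" if xy: "x \<in> A" "y \<in> A" for x y
  proof (cases "q x = q y")
    case True
    \<comment> \<open>With \<open>R\<close> and \<open>R'\<close> irreflexive, this removes the
      diagonal that was added to the orders on the fibres.\<close>
    have "x = y \<longleftrightarrow> f x = f y"
      using inj xy by (auto dest: inj_onD)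
    then show ?thesis
      using F'[of x "q x" y] xy True R R'
      by (simp add: f_def fibrewise_linear_def irrefl_def) metis
  next
    case False
    have "(x, y) \<in> R \<longleftrightarrow> q y < q x"
      using R xy False by (auto simp: fibrewise_linear_def)
    moreover have "(f x, f y) \<in> R' \<longleftrightarrow> q (f y) < q (f x)"
      using R' fA[OF xy(1)] fA[OF xy(2)] False by (auto simp: fibrewise_linear_def)
    ultimately show ?thesis
      using fA xy by simp
  qed
  ultimately show thesis
    using that by blast
qed

section \<open>Digraph isomorphisms from bijections of the vertices\<close>

lemma digraph_iso_with_projI:
  assumes "parcs D \<subseteq> pverts D \<times> pverts D" "parcs E \<subseteq> pverts E \<times> pverts E"
    and f: "bij_betw f (pverts D) (pverts E)"
    and arcs: "\<And>x y. x \<in> pverts D \<Longrightarrow> y \<in> pverts D \<Longrightarrow> (x, y) \<in> parcs D \<longleftrightarrow> (f x, f y) \<in> parcs E"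
  shows "digraph_iso (with_proj D) (with_proj E)"
proof -
  \<comment> \<open>The arcs of \<open>with_proj\<close> are pairs, so \<open>f\<close> acts on both
    ends, while head and tail remain the projections.\<close>
  let ?h = "\<lparr> iso_verts = f, iso_arcs = map_prod f f, iso_head = snd, iso_tail = fst \<rparr>"
  have "wf_digraph (with_proj D)"
    using assms(1) by unfold_locales auto
  moreover have "inj_on (map_prod f f) (parcs D)"
    using map_prod_inj_on[of f "pverts D" f "pverts D"] f assms(1)
    by (meson bij_betw_def inj_on_subset)
  ultimately have "pre_digraph.digraph_isomorphism (with_proj D) ?h"
    using f by (auto simp: pre_digraph.digraph_isomorphism_def bij_betw_def)
  moreover have "map_prod f f ` parcs D = parcs E"
  proof (intro equalityI subsetI)
    fix e assume "e \<in> map_prod f f ` parcs D"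
    then show "e \<in> parcs E"
      using arcs assms(1) by auto
  next
    fix e assume e: "e \<in> parcs E"
    then have "fst e \<in> f ` pverts D" "snd e \<in> f ` pverts D"
      using assms(2) bij_betw_imp_surj_on[OF f] by auto
    then obtain x y where "e = (f x, f y)" "x \<in> pverts D" "y \<in> pverts D"
      by (metis imageE prod.collapse)
    then show "e \<in> map_prod f f ` parcs D"
      using arcs e by force
  qed
  then have "with_proj E = app_iso ?h (with_proj D)"
    using f by (simp add: app_iso_def with_proj_def bij_betw_def)
  ultimately show ?thesis
    unfolding digraph_iso_def by blast
qed

section \<open>Power graphs and cyclic subgroups\<close>

context group
begin

lemma is_pos_power_iff_generate:
  assumes "finite (carrier G)" "x \<in> carrier G" "y \<in> carrier G"
  shows "is_pos_power G y x \<longleftrightarrow> generate G {y} \<subseteq> generate G {x}"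
proof
  assume "is_pos_power G y x"
  then have "y \<in> generate G {x}"
    using assms by (auto simp: is_pos_power_def generate_pow_on_finite_carrier)
  then show "generate G {y} \<subseteq> generate G {x}"
    using assms generate_subgroup_incl[of "{y}"] generate_is_subgroup[of "{x}"] by simp
next
  assume "generate G {y} \<subseteq> generate G {x}"
  then have "y \<in> generate G {x}"
    using generate.incl[of y "{y}" G] by auto
  then obtain k :: nat where "y = x [^] k"
    using assms by (auto simp: generate_pow_on_finite_carrier)
  \<comment> \<open>The shift by \<open>ord x\<close> makes the exponent positive even if
    \<open>k = 0\<close>, as happens when \<open>y\<close> is the identity.\<close>
  also have "\<dots> = x [^] (k + ord x)"
    using assms by (simp add: nat_pow_mult[symmetric])
  finally show "is_pos_power G y x"
    using ord_ge_1[of x] assms unfolding is_pos_power_def by (intro exI[of _ "k + ord x"]) auto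
qed

text \<open>Membership in \<open>generate G {x}\<close> is automatic, because \<open>y\<close> lies
  in the subgroup that it generates.\<close>

lemma gen_class_eq:
  assumes "x \<in> carrier G"
  shows "gen_class G x = {y \<in> carrier G. generate G {y} = generate G {x}}"
  using assms generate.incl[of _ "{_}" G] generate_in_carrier[of "{x}"]
  by (auto simp: gen_class_def)

lemma gen_class_eq_iff:
  assumes "x \<in> carrier G" "y \<in> carrier G"
  shows "gen_class G x = gen_class G y \<longleftrightarrow> generate G {x} = generate G {y}"
  using assms by (auto simp: gen_class_eq)

text \<open>Lying inside the power digraph fixes the direction of each edge between different cyclic
  subgroups. Inside a class all pairs are edges, so a transitive orientation is a strict linear
  order there.\<close>

lemma transitive_power_orientation_iff:
  assumes "finite (carrier G)"
  shows "transitive_orientation (power_graph G) D \<and>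
      subgraph (with_proj D) (with_proj (power_digraph G)) \<longleftrightarrow>
    pverts D = carrier G \<and> fibrewise_linear (carrier G) (\<lambda>x. generate G {x}) (parcs D)"
    (is "?L \<longleftrightarrow> ?R")
proof
  assume ?L
  then have "pverts D = carrier G" "trans (parcs D)" and sub: "parcs D \<subseteq> parcs (power_digraph G)"
    and or: "\<And>u v. (u, v) \<in> parcs (power_graph G) \<Longrightarrow> (u, v) \<in> parcs D \<longleftrightarrow> (v, u) \<notin> parcs D"
    by (auto simp: transitive_orientation_def orientation_def power_graph_def subgraph_def)
  have arc: "x \<in> carrier G" "y \<in> carrier G" "x \<noteq> y" "generate G {y} \<subseteq> generate G {x}"
    if "(x, y) \<in> parcs D" for x y
    using subsetD[OF sub that] is_pos_power_iff_generate[OF assms, of x y]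
    by (auto simp: power_digraph_def)
  show ?R
    unfolding fibrewise_linear_def
  proof (intro conjI ballI impI)
    show "pverts D = carrier G" "trans (parcs D)"
      by fact+
    show "irrefl (parcs D)"
      using arc(3) by (auto simp: irrefl_def)
    show "parcs D \<subseteq> carrier G \<times> carrier G"
      using arc(1,2) by auto
    show "case e of (x, y) \<Rightarrow> generate G {y} \<subseteq> generate G {x}" if "e \<in> parcs D" for e
      using that arc(4) by (cases e) simp
    fix x y assume xy: "x \<in> carrier G" "y \<in> carrier G"
    show "(x, y) \<in> parcs D" if "generate G {y} \<subset> generate G {x}"
    proof -
      have "(x, y) \<in> parcs (power_graph G)"
        using that xy by (auto simp: power_graph_def is_pos_power_iff_generate[OF assms])
      \<comment> \<open>The upward arc is not in the power digraph, so the orientation must choose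
        the downward one.\<close>
      moreover have "(y, x) \<notin> parcs D"
        using that arc(4)[of y x] by auto
      ultimately show ?thesis
        using or by blast
    qed
    show "(x, y) \<in> parcs D \<or> (y, x) \<in> parcs D" if "generate G {x} = generate G {y}" "x \<noteq> y"
      using or[of x y] that xy by (simp add: power_graph_def is_pos_power_iff_generate[OF assms])
  qed
next
  assume R: ?R
  have sub: "parcs D \<subseteq> parcs (power_digraph G)"
  proof (rule subrelI)
    fix x y assume xy: "(x, y) \<in> parcs D"
    then have "x \<in> carrier G" "y \<in> carrier G" "x \<noteq> y" "generate G {y} \<subseteq> generate G {x}"
      using R unfolding fibrewise_linear_def irrefl_def by blast+
    then show "(x, y) \<in> parcs (power_digraph G)"
      by (simp add: power_digraph_def is_pos_power_iff_generate[OF assms])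
  qed
  have "wf_digraph (with_proj D)" "wf_digraph (with_proj (power_digraph G))"
    using R by (unfold_locales, auto simp: power_digraph_def fibrewise_linear_def)
  then have "subgraph (with_proj D) (with_proj (power_digraph G))"
    using R sub by (auto simp: subgraph_def power_digraph_def compatible_def)
  moreover have "orientation (power_graph G) D"
    unfolding orientation_def
  proof (intro conjI ballI)
    show "parcs D \<subseteq> parcs (power_graph G)"
      using sub by (auto simp: power_digraph_def power_graph_def)
    show "pverts D = pverts (power_graph G)"
      using R by (simp add: power_graph_def)
    fix e assume "e \<in> parcs (power_graph G)"
    then obtain u v where e: "e = (u, v)" and uv: "u \<in> carrier G" "v \<in> carrier G" "u \<noteq> v"
      and comparable: "generate G {u} \<subseteq> generate G {v} \<or> generate G {v} \<subseteq> generate G {u}"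
      by (auto simp: power_graph_def is_pos_power_iff_generate[OF assms])
    \<comment> \<open>Two opposite arcs would yield a loop by transitivity.\<close>
    have "(u, v) \<notin> parcs D \<or> (v, u) \<notin> parcs D"
      using R by (auto simp: fibrewise_linear_def irrefl_def dest: transD)
    \<comment> \<open>A proper inclusion forces the downward arc; equal subgroups are covered by
      totality on the fibre.\<close>
    moreover have "(u, v) \<in> parcs D \<or> (v, u) \<in> parcs D"
      using R uv comparable unfolding fibrewise_linear_def by (metis psubsetI)
    ultimately show "case e of (u, v) \<Rightarrow> ((u, v) \<in> parcs D) \<noteq> ((v, u) \<in> parcs D)"
      using e by auto
  qed
  then have "transitive_orientation (power_graph G) D"
    using R by (simp add: transitive_orientation_def fibrewise_linear_def)
  ultimately show ?L
    by blast
qed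

text \<open>Arcs run against \<open>prec\<close>, so inside a class they form the converse of the
  strict part of \<open>L\<close>.\<close>

lemma fibrewise_linear_order_digraph:
  assumes "\<And>C. C \<in> gen_class G ` carrier G \<Longrightarrow> linear_order_on C (L C)"
  shows "fibrewise_linear (carrier G) (\<lambda>x. generate G {x}) (parcs (order_digraph G L))"
proof -
  have L: "trans (L (gen_class G x))" "antisym (L (gen_class G x))"
    "total_on (gen_class G x) (L (gen_class G x))"
    if "x \<in> carrier G" for x
    using assms that by (auto simp: order_on_defs)
  have arc: "(x, y) \<in> parcs (order_digraph G L) \<longleftrightarrow> x \<in> carrier G \<and> y \<in> carrier G \<and>
      (generate G {x} = generate G {y} \<and> (y, x) \<in> L (gen_class G x) \<and> x \<noteq> y \<or>
       generate G {y} \<subset> generate G {x})" for x y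
    using gen_class_eq_iff[of x y] unfolding order_digraph_def prec_def by simp metis
  have "trans (parcs (order_digraph G L))"
  proof (rule transI)
    fix x y z assume xy: "(x, y) \<in> parcs (order_digraph G L)" and yz: "(y, z) \<in> parcs (order_digraph G L)"
    have c: "x \<in> carrier G" "y \<in> carrier G" "z \<in> carrier G"
      using xy yz by (auto simp: arc)
    show "(x, z) \<in> parcs (order_digraph G L)"
    \<comment> \<open>Within one class the order \<open>L\<close> is transitive, and its
      antisymmetry excludes \<open>x = z\<close>. Otherwise one of the two inclusions is proper,
      hence so is their composite.\<close>
    proof (cases "generate G {x} = generate G {y} \<and> generate G {y} = generate G {z}")
      case True
      then have "gen_class G x = gen_class G y"
        using c gen_class_eq_iff by simp
      then show ?thesis
        using xy yz True transD[OF L(1)[OF c(1)], of z y x] antisymD[OF L(2)[OF c(1)], of y x]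
        by (auto simp: arc)
    next
      case False
      then show ?thesis
        using xy yz unfolding arc by auto
    qed
  qed
  moreover have "(x, y) \<in> parcs (order_digraph G L) \<or> (y, x) \<in> parcs (order_digraph G L)"
    if "x \<in> carrier G" "y \<in> carrier G" "generate G {x} = generate G {y}" "x \<noteq> y" for x y
  proof -
    have "gen_class G x = gen_class G y"
      using that gen_class_eq_iff by simp
    moreover have "(x, y) \<in> L (gen_class G x) \<or> (y, x) \<in> L (gen_class G x)"
      using L(3)[OF that(1)] that by (auto simp: total_on_def gen_class_eq)
    ultimately show ?thesis
      using that by (auto simp: arc)
  qed
  moreover have "irrefl (parcs (order_digraph G L))"
    by (auto simp: irrefl_def arc)
  moreover have "\<forall>(x, y)\<in>parcs (order_digraph G L). generate G {y} \<subseteq> generate G {x}"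
    by (auto simp: arc)
  moreover have "parcs (order_digraph G L) \<subseteq> carrier G \<times> carrier G"
    by (auto simp: arc)
  moreover have "(x, y) \<in> parcs (order_digraph G L)"
    if "x \<in> carrier G" "y \<in> carrier G" "generate G {y} \<subset> generate G {x}" for x y
    using that by (simp add: arc)
  ultimately show ?thesis
    unfolding fibrewise_linear_def by blast
qed

end

theorem theorem2p3:
  fixes G :: "('a, 'b) monoid_scheme" and L :: "'a set \<Rightarrow> 'a rel"
  assumes "group G" and "finite (carrier G)"
    and "\<And>C. C \<in> gen_class G ` carrier G \<Longrightarrow> linear_order_on C (L C)"
  shows "transitive_orientation (power_graph G) (order_digraph G L) \<and>
         subgraph (with_proj (order_digraph G L)) (with_proj (power_digraph G)) \<and>
         (\<forall>D. transitive_orientation (power_graph G) D \<and>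
              subgraph (with_proj D) (with_proj (power_digraph G)) \<longrightarrow>
              digraph_iso (with_proj D) (with_proj (order_digraph G L)))"
proof -
  interpret group G
    by fact
  \<comment> \<open>Read from right to left this gives the claims about
    \<open>order_digraph G L\<close>; read from left to right it makes any competitor
    \<open>D\<close> fibrewise linear for the same \<open>q\<close>.\<close>
  note char = transitive_power_orientation_iff[OF assms(2)]
  have O: "fibrewise_linear (carrier G) (\<lambda>x. generate G {x}) (parcs (order_digraph G L))"
    using assms(3) by (rule fibrewise_linear_order_digraph)
  have V: "pverts (order_digraph G L) = carrier G"
    by (simp add: order_digraph_def)
  have "digraph_iso (with_proj D) (with_proj (order_digraph G L))"
    if "transitive_orientation (power_graph G) D \<and>
      subgraph (with_proj D) (with_proj (power_digraph G))" for D
  proof -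
    have D: "pverts D = carrier G" "fibrewise_linear (carrier G) (\<lambda>x. generate G {x}) (parcs D)"
      using that char by auto
    obtain f where "bij_betw f (carrier G) (carrier G)"
      "\<And>x y. x \<in> carrier G \<Longrightarrow> y \<in> carrier G \<Longrightarrow>
        (x, y) \<in> parcs D \<longleftrightarrow> (f x, f y) \<in> parcs (order_digraph G L)"
      using fibrewise_linear_iso[OF assms(2) D(2) O] by blast
    then show ?thesis
      using D O V by (intro digraph_iso_with_projI[of _ _ f]) (auto simp: fibrewise_linear_def)
  qed
  then show ?thesis
    using char[of "order_digraph G L"] O V by blast
qed

end
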